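(* Let $K\subset\mathbb{H}^2$ be a convex body. Then $$\mathrm{diam}\,K=\max\{w_{JCJL}(K,(z,\ell_z,z')) : z,z'\in\partial K\text{ are opposite with respect to }\ell_z\},$$ where $\ell_z$ ranges over the supporting lines of $K$ at $z$.
   Context: $\mathbb{H}^2$ is the hyperbolic plane with geodesic distance $d$. A convex body is a compact (geodesically) convex set with non-empty interior. A line supports $K$ at $z\in\partial K$ if it contains $z$ and $K$ lies in one of the closed half-planes it bounds. For $z\in\partial K$ and a supporting line $\ell_z$ of $K$ at $z$, a point $z'\in\partial K$ is opposite to $z$ with respect to $\ell_z$ if there is a supporting line $\ell_{z'}$ of $K$ at $z'$ such that $\ell_z$ and $\ell_{z'}$ have equal alternating angles with the segment $[z,z']$ (i.e. the point reflection in the midpoint of $[z,z']$ maps $\ell_z$ to $\ell_{z'}$), where $z'\neq z$ and $\ell_{z'}\ne\ell_z$. Then the Jerónimo-Castro--Jimenez-Lopez width is $w_{JCJL}(K,(z,\ell_z,z'))=d(\ell_z,\ell_{z'})$, the distance of the two lines. *)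

theory Defs
  imports "HOL-Analysis.Analysis"
begin

text \<open>
  The hyperbolic plane is realised as the upper sheet of the two-sheeted hyperboloid in
  Minkowski space, with the geodesic distance \<open>arcosh (- B x y)\<close>.
\<close>

definition mink :: "real ^ 3 \<Rightarrow> real ^ 3 \<Rightarrow> real" where
  "mink x y = x $ 1 * y $ 1 + x $ 2 * y $ 2 - x $ 3 * y $ 3"

lemma mink_commute: "mink x y = mink y x"
  by (simp add: mink_def algebra_simps)

lemma mink_add_left: "mink (x + y) z = mink x z + mink y z"
  and mink_add_right: "mink z (x + y) = mink z x + mink z y"
  and mink_diff_left: "mink (x - y) z = mink x z - mink y z"
  and mink_diff_right: "mink z (x - y) = mink z x - mink z y"
  and mink_scaleR_left: "mink (c *\<^sub>R x) z = c * mink x z"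
  and mink_scaleR_right: "mink z (c *\<^sub>R x) = c * mink z x"
  by (simp_all add: mink_def algebra_simps)

lemmas mink_simps = mink_add_left mink_add_right mink_diff_left mink_diff_right
  mink_scaleR_left mink_scaleR_right

typedef hyp_plane = "{x :: real ^ 3. mink x x = -1 \<and> x $ 3 > 0}"
  morphisms coords Abs_hyp_plane
  by (rule exI[of _ "vector [0, 0, 1]"]) (simp add: mink_def vector_3)

setup_lifting type_definition_hyp_plane

lemma mink_coords_self [simp]: "mink (coords p) (coords p) = -1"
  and coords_3_pos: "coords p $ 3 > 0"
  using coords[of p] by auto

lemma mink_le_minus_one:
  assumes "mink x x = -1" "x $ 3 > 0" "mink y y = -1" "y $ 3 > 0"
  shows "mink x y \<le> -1"
proof -
  define a b c where "a = x $ 1" and "b = x $ 2" and "c = x $ 3"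
  define a' b' c' where "a' = y $ 1" and "b' = y $ 2" and "c' = y $ 3"
  note defs = a_def b_def c_def a'_def b'_def c'_def
  have c: "c\<^sup>2 = a\<^sup>2 + b\<^sup>2 + 1" "c'\<^sup>2 = a'\<^sup>2 + b'\<^sup>2 + 1" "c > 0" "c' > 0"
    using assms by (auto simp: defs mink_def power2_eq_square)
  have "(c * c')\<^sup>2 - (1 + a * a' + b * b')\<^sup>2 = (a - a')\<^sup>2 + (b - b')\<^sup>2 + (a * b' - a' * b)\<^sup>2"
    unfolding power_mult_distrib c by (simp add: power2_eq_square algebra_simps)
  then have "(1 + a * a' + b * b')\<^sup>2 \<le> (c * c')\<^sup>2"
    by (smt (verit) zero_le_power2)
  then have "1 + a * a' + b * b' \<le> c * c'"
    by (rule power2_le_imp_le) (use c in auto)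
  then show ?thesis by (simp add: mink_def defs)
qed

lemma mink_coords_le: "mink (coords p) (coords q) \<le> -1"
  by (rule mink_le_minus_one) (auto simp: coords_3_pos)

lemma mink_coords_eq_iff: "mink (coords p) (coords q) = -1 \<longleftrightarrow> p = q"
proof
  assume eq: "mink (coords p) (coords q) = -1"
  define x y where "x = coords p" and "y = coords q"
  define a b c where "a = x $ 1" and "b = x $ 2" and "c = x $ 3"
  define a' b' c' where "a' = y $ 1" and "b' = y $ 2" and "c' = y $ 3"
  note defs = a_def b_def c_def a'_def b'_def c'_def
  have c: "c\<^sup>2 = a\<^sup>2 + b\<^sup>2 + 1" "c'\<^sup>2 = a'\<^sup>2 + b'\<^sup>2 + 1" "c > 0" "c' > 0"
    using mink_coords_self[of p] mink_coords_self[of q] coords_3_pos[of p] coords_3_pos[of q]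
    by (auto simp: defs x_def y_def mink_def power2_eq_square)
  have e: "c * c' = 1 + a * a' + b * b'"
    using eq by (simp add: defs x_def y_def mink_def)
  have "(c * c')\<^sup>2 - (1 + a * a' + b * b')\<^sup>2 = (a - a')\<^sup>2 + (b - b')\<^sup>2 + (a * b' - a' * b)\<^sup>2"
    unfolding power_mult_distrib c by (simp add: power2_eq_square algebra_simps)
  then have "(a - a')\<^sup>2 + (b - b')\<^sup>2 + (a * b' - a' * b)\<^sup>2 = 0"
    by (simp add: e)
  then have ab: "a = a'" "b = b'"
    by (smt (verit) zero_le_power2 zero_eq_power2)+
  then have "c\<^sup>2 = c'\<^sup>2" using c by simp
  then have "c = c'" using c(3,4) power2_eq_iff_nonneg[of c c'] by linarith
  with ab have "x = y"
    by (simp add: defs vec_eq_iff forall_3)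
  then show "p = q" by (simp add: x_def y_def coords_inject)
qed simp

lemma mink_orth_nonneg:
  assumes m: "mink m m = -1" and orth: "mink v m = 0"
  shows "mink v v \<ge> 0"
proof -
  define a b c where "a = v $ 1" and "b = v $ 2" and "c = v $ 3"
  define a' b' c' where "a' = m $ 1" and "b' = m $ 2" and "c' = m $ 3"
  note defs = a_def b_def c_def a'_def b'_def c'_def
  have c: "c'\<^sup>2 = a'\<^sup>2 + b'\<^sup>2 + 1" "c * c' = a * a' + b * b'"
    using assms by (auto simp: defs mink_def power2_eq_square)
  have "(a\<^sup>2 + b\<^sup>2 - c\<^sup>2) * c'\<^sup>2 = (a\<^sup>2 + b\<^sup>2) * c'\<^sup>2 - (c * c')\<^sup>2"
    by (simp add: power2_eq_square algebra_simps)
  also have "\<dots> = a\<^sup>2 + b\<^sup>2 + (a * b' - b * a')\<^sup>2"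
    unfolding c by (simp add: power2_eq_square algebra_simps)
  finally have "(a\<^sup>2 + b\<^sup>2 - c\<^sup>2) * c'\<^sup>2 \<ge> 0"
    by simp
  moreover have "c'\<^sup>2 > 0"
    unfolding c(1) by (simp add: add_nonneg_pos)
  ultimately have "a\<^sup>2 + b\<^sup>2 - c\<^sup>2 \<ge> 0"
    by (simp add: zero_le_mult_iff)
  then show ?thesis
    by (simp add: mink_def defs power2_eq_square)
qed

lemma mink_orth_eq_0:
  assumes m: "mink m m = -1" and orth: "mink v m = 0" and null: "mink v v = 0"
  shows "v = 0"
proof -
  define a b c where "a = v $ 1" and "b = v $ 2" and "c = v $ 3"
  define a' b' c' where "a' = m $ 1" and "b' = m $ 2" and "c' = m $ 3"
  note defs = a_def b_def c_def a'_def b'_def c'_def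
  have c: "c'\<^sup>2 = a'\<^sup>2 + b'\<^sup>2 + 1" "c\<^sup>2 = a\<^sup>2 + b\<^sup>2" "c * c' = a * a' + b * b'"
    using assms by (auto simp: defs mink_def power2_eq_square)
  have "(c * c')\<^sup>2 - (a * a' + b * b')\<^sup>2 = a\<^sup>2 + b\<^sup>2 + (a * b' - b * a')\<^sup>2"
    unfolding power_mult_distrib c(1,2) by (simp add: power2_eq_square algebra_simps)
  then have "a\<^sup>2 + b\<^sup>2 + (a * b' - b * a')\<^sup>2 = 0"
    by (simp add: c(3))
  then have "a = 0" "b = 0"
    by (smt (verit) zero_le_power2 zero_eq_power2)+
  with c(2) show ?thesis
    by (simp add: defs vec_eq_iff forall_3)
qed

text \<open>
  The Cauchy-Schwarz inequality on the orthogonal complement of \<open>coords q\<close>; it yields the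
  triangle inequality.
\<close>

lemma mink_Cauchy_Schwarz:
  fixes p q r :: hyp_plane
  defines "x \<equiv> coords p" and "y \<equiv> coords q" and "z \<equiv> coords r"
  shows "(mink x z + mink x y * mink y z)\<^sup>2 \<le> ((mink x y)\<^sup>2 - 1) * ((mink y z)\<^sup>2 - 1)"
proof -
  have m: "mink x x = -1" "mink y y = -1" "mink z z = -1" "mink y x = mink x y"
    "mink z x = mink x z" "mink z y = mink y z"
    by (simp_all add: x_def y_def z_def mink_commute)
  define u v where "u = x + mink x y *\<^sub>R y" and "v = z + mink y z *\<^sub>R y"
  have uy: "mink u y = 0" and vy: "mink v y = 0"
    by (simp_all add: u_def v_def mink_simps m)
  have uu: "mink u u = (mink x y)\<^sup>2 - 1" and vv: "mink v v = (mink y z)\<^sup>2 - 1"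
    and uv: "mink u v = mink x z + mink x y * mink y z"
    by (simp_all add: u_def v_def mink_simps m power2_eq_square)
  have "(mink u v)\<^sup>2 \<le> mink u u * mink v v"
  proof (cases "mink v v = 0")
    case True
    then have "v = 0"
      using mink_orth_eq_0[of y v] m(2) vy by simp
    then show ?thesis
      by (simp add: mink_def)
  next
    case False
    then have pos: "mink v v > 0"
      using mink_orth_nonneg[of y v] m(2) vy by simp
    define w where "w = mink v v *\<^sub>R u - mink u v *\<^sub>R v"
    have "mink w y = 0"
      by (simp add: w_def mink_simps uy vy)
    then have "0 \<le> mink w w"
      using mink_orth_nonneg[of y w] m(2) by simp
    also have "mink w w = mink v v * (mink u u * mink v v - (mink u v)\<^sup>2)"
      unfolding w_def mink_simps mink_commute[of v u]
      by (simp add: power2_eq_square algebra_simps)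
    finally show ?thesis
      using pos by (simp add: zero_le_mult_iff)
  qed
  then show ?thesis
    by (simp only: uu vv uv)
qed

instantiation hyp_plane :: metric_space
begin

definition dist_hyp_plane :: "hyp_plane \<Rightarrow> hyp_plane \<Rightarrow> real" where
  "dist p q = arcosh (- mink (coords p) (coords q))"

definition uniformity_hyp_plane :: "(hyp_plane \<times> hyp_plane) filter" where
  "uniformity_hyp_plane = (INF e\<in>{0 <..}. principal {(x, y). dist x y < e})"

definition open_hyp_plane :: "hyp_plane set \<Rightarrow> bool" where
  "open_hyp_plane U \<longleftrightarrow> (\<forall>x\<in>U. eventually (\<lambda>(x', y). x' = x \<longrightarrow> y \<in> U) uniformity)"

instance
proof
  fix x y z :: hyp_plane
  show "dist x y = 0 \<longleftrightarrow> x = y"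
  proof -
    have "dist x y = 0 \<longleftrightarrow> - mink (coords x) (coords y) = 1"
      using mink_coords_le[of x y] cosh_arcosh_real[of "- mink (coords x) (coords y)"]
      by (auto simp: dist_hyp_plane_def)
    then show ?thesis
      using mink_coords_eq_iff[of x y] by linarith
  qed
  define a b c where "a = - mink (coords x) (coords z)"
    and "b = - mink (coords z) (coords y)" and "c = - mink (coords x) (coords y)"
  have ge: "a \<ge> 1" "b \<ge> 1" "c \<ge> 1"
    using mink_coords_le by (simp_all add: a_def b_def c_def minus_le_iff)
  have "(c - a * b)\<^sup>2 \<le> (a\<^sup>2 - 1) * (b\<^sup>2 - 1)"
  proof -
    have "(- c + a * b)\<^sup>2 \<le> (a\<^sup>2 - 1) * (b\<^sup>2 - 1)"
      using mink_Cauchy_Schwarz[where p = x and q = z and r = y] by (simp add: a_def b_def c_def)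
    moreover have "(c - a * b)\<^sup>2 = (- c + a * b)\<^sup>2"
      by (simp add: power2_eq_square algebra_simps)
    ultimately show ?thesis by linarith
  qed
  then have "c \<le> a * b + sqrt (a\<^sup>2 - 1) * sqrt (b\<^sup>2 - 1)"
    using real_le_rsqrt real_sqrt_mult by fastforce
  also have "\<dots> = cosh (arcosh a + arcosh b)"
    using ge by (simp add: cosh_add sinh_arcosh_real)
  finally have "cosh (arcosh c) \<le> cosh (arcosh a + arcosh b)"
    using ge by simp
  moreover have "arcosh a \<ge> 0" "arcosh b \<ge> 0" "arcosh c \<ge> 0"
    using ge by (simp_all add: arcosh_nonneg_real)
  ultimately have "arcosh c \<le> arcosh a + arcosh b"
    by (simp add: cosh_real_nonneg_le_iff)
  then show "dist x y \<le> dist x z + dist y z"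
    by (simp add: dist_hyp_plane_def a_def b_def c_def mink_commute)
qed (simp_all add: uniformity_hyp_plane_def open_hyp_plane_def)

end

lemma cosh_dist: "cosh (dist p q) = - mink (coords p) (coords q)"
  using mink_coords_le[of p q] by (simp add: dist_hyp_plane_def)

text \<open>Geodesic segments: the central projections of chords to the hyperboloid.\<close>

definition hyp_segment :: "hyp_plane \<Rightarrow> hyp_plane \<Rightarrow> hyp_plane set" where
  "hyp_segment p q =
     {r. \<exists>s t. s \<ge> 0 \<and> t \<ge> 0 \<and> coords r = s *\<^sub>R coords p + t *\<^sub>R coords q}"

definition hyp_convex :: "hyp_plane set \<Rightarrow> bool" where
  "hyp_convex K \<longleftrightarrow> (\<forall>p\<in>K. \<forall>q\<in>K. hyp_segment p q \<subseteq> K)"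

definition convex_body :: "hyp_plane set \<Rightarrow> bool" where
  "convex_body K \<longleftrightarrow> compact K \<and> hyp_convex K \<and> interior K \<noteq> {}"

text \<open>
  Lines are the nonempty sections with planes through the origin, i.e. with Minkowski-orthogonal
  complements of spacelike vectors \<open>n\<close>. The other closed half-plane bounded by
  \<open>line_of n\<close> is \<open>half_plane (- n)\<close>.
\<close>

definition spacelike :: "real ^ 3 \<Rightarrow> bool" where
  "spacelike n \<longleftrightarrow> mink n n > 0"

definition line_of :: "real ^ 3 \<Rightarrow> hyp_plane set" where
  "line_of n = {p. mink n (coords p) = 0}"

definition half_plane :: "real ^ 3 \<Rightarrow> hyp_plane set" where
  "half_plane n = {p. mink n (coords p) \<le> 0}"

definition supporting_line :: "hyp_plane set \<Rightarrow> hyp_plane \<Rightarrow> hyp_plane set \<Rightarrow> bool" where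
  "supporting_line K z l \<longleftrightarrow> z \<in> frontier K \<and> z \<in> l \<and>
     (\<exists>n. spacelike n \<and> l = line_of n \<and> K \<subseteq> half_plane n)"

lift_definition hyp_midpoint :: "hyp_plane \<Rightarrow> hyp_plane \<Rightarrow> hyp_plane"
  is "\<lambda>x y. (1 / sqrt (- mink (x + y) (x + y))) *\<^sub>R (x + y)"
proof -
  fix x y :: "real ^ 3"
  assume xy: "mink x x = -1 \<and> 0 < x $ 3" "mink y y = -1 \<and> 0 < y $ 3"
  define u where "u = x + y"
  have "mink u u < 0"
    using mink_le_minus_one[of x y] xy by (simp add: u_def mink_simps mink_commute[of y x])
  moreover have "u $ 3 > 0"
    using xy by (simp add: u_def)
  ultimately have "mink ((1 / sqrt (- mink u u)) *\<^sub>R u) ((1 / sqrt (- mink u u)) *\<^sub>R u) = -1 \<and>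
      0 < ((1 / sqrt (- mink u u)) *\<^sub>R u) $ 3"
    by (simp add: mink_scaleR_left mink_scaleR_right field_simps)
  then show "mink ((1 / sqrt (- mink (x + y) (x + y))) *\<^sub>R (x + y))
      ((1 / sqrt (- mink (x + y) (x + y))) *\<^sub>R (x + y)) = -1 \<and>
    0 < ((1 / sqrt (- mink (x + y) (x + y))) *\<^sub>R (x + y)) $ 3"
    by (simp only: u_def)
qed

text \<open>
  The point reflection fixes \<open>m\<close> and acts as \<open>-1\<close> on the Minkowski-orthogonal complement
  of \<open>m\<close>.
\<close>

lift_definition point_reflection :: "hyp_plane \<Rightarrow> hyp_plane \<Rightarrow> hyp_plane"
  is "\<lambda>m x. (- 2 * mink m x) *\<^sub>R m - x"
proof -
  fix m x :: "real ^ 3"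
  assume m: "mink m m = -1 \<and> 0 < m $ 3" and x: "mink x x = -1 \<and> 0 < x $ 3"
  let ?k = "- 2 * mink m x" and ?r = "(- 2 * mink m x) *\<^sub>R m - x"
  have 1: "mink ?r ?r = -1"
    using m x
    by (simp only: mink_simps mink_commute[of x m]) (simp add: algebra_simps)
  have "mink ?r m = mink m x"
    using m by (simp only: mink_simps mink_commute[of x m])
  then have le: "mink ?r m \<le> -1"
    using mink_le_minus_one[of m x] m x by simp
  have "0 < ?r $ 3"
  proof (rule ccontr)
    assume neg: "\<not> 0 < ?r $ 3"
    have "?r $ 3 \<noteq> 0"
    proof
      assume "?r $ 3 = 0"
      then have "mink ?r ?r = (?r $ 1)\<^sup>2 + (?r $ 2)\<^sup>2"
        by (simp only: mink_def) (simp add: power2_eq_square)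
      then show False using 1 by (smt (verit) zero_le_power2)
    qed
    with neg have "(- ?r) $ 3 > 0" by simp
    moreover have neg: "mink (- u) (- u) = mink u u" "mink (- u) v = - mink u v" for u v
      by (simp_all add: mink_def)
    ultimately have "mink (- ?r) m \<le> -1"
      using 1 m by (intro mink_le_minus_one) (auto simp only: neg)
    then show False using le neg(2)[of ?r m] by linarith
  qed
  with 1 show "mink ?r ?r = -1 \<and> 0 < ?r $ 3" by blast
qed

text \<open>
  The line \<open>l'\<close> witnesses that \<open>z'\<close> is opposite to \<open>z\<close> with respect to \<open>l\<close>; equality of the
  alternating angles is expressed by the point reflection in the midpoint of the segment.
\<close>

definition opposite_line ::
  "hyp_plane set \<Rightarrow> hyp_plane \<Rightarrow> hyp_plane set \<Rightarrow> hyp_plane \<Rightarrow> hyp_plane set \<Rightarrow> bool" where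
  "opposite_line K z l z' l' \<longleftrightarrow> supporting_line K z' l' \<and>
     point_reflection (hyp_midpoint z z') ` l = l' \<and> l' \<noteq> l"

definition opposite ::
  "hyp_plane set \<Rightarrow> hyp_plane \<Rightarrow> hyp_plane set \<Rightarrow> hyp_plane \<Rightarrow> bool" where
  "opposite K z l z' \<longleftrightarrow> supporting_line K z l \<and> z' \<noteq> z \<and> (\<exists>l'. opposite_line K z l z' l')"

definition jcjl_width ::
  "hyp_plane set \<Rightarrow> hyp_plane \<Rightarrow> hyp_plane set \<Rightarrow> hyp_plane \<Rightarrow> real" where
  "jcjl_width K z l z' = setdist l (THE l'. opposite_line K z l z' l')"

lemma jcjl_width_eq:
  assumes "opposite_line K z l z' l'"
  shows "jcjl_width K z l z' = setdist l l'"
proof -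
  have "(THE l'. opposite_line K z l z' l') = l'"
    using assms by (intro the_equality) (auto simp: opposite_line_def)
  then show ?thesis by (simp add: jcjl_width_def)
qed

text \<open>
  The coordinate definitions agree with the metric notions: segments are metric segments, the
  midpoint is equidistant from the endpoints, and the point reflection is an isometry under which
  every point is symmetric about the centre.
\<close>

lemma dist_add_eq_iff:
  fixes p q r :: hyp_plane
  defines "a \<equiv> - mink (coords p) (coords r)" and "b \<equiv> - mink (coords r) (coords q)"
    and "c \<equiv> - mink (coords p) (coords q)"
  shows "dist p r + dist r q = dist p q \<longleftrightarrow> c = a * b + sqrt (a\<^sup>2 - 1) * sqrt (b\<^sup>2 - 1)"
proof -
  have ge: "a \<ge> 1" "b \<ge> 1" "c \<ge> 1"
    using mink_coords_le by (simp_all add: a_def b_def c_def minus_le_iff)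
  have "dist p r + dist r q = dist p q \<longleftrightarrow> cosh (dist p r + dist r q) = cosh (dist p q)"
    by (metis add_nonneg_nonneg arcosh_cosh_real zero_le_dist)
  also have "cosh (dist p q) = c"
    by (simp add: cosh_dist c_def)
  also have "cosh (dist p r + dist r q) = a * b + sqrt (a\<^sup>2 - 1) * sqrt (b\<^sup>2 - 1)"
    unfolding dist_hyp_plane_def a_def[symmetric] b_def[symmetric]
    using ge by (simp add: cosh_add sinh_arcosh_real)
  finally show ?thesis by auto
qed

lemma hyp_segment_iff: "r \<in> hyp_segment p q \<longleftrightarrow> dist p r + dist r q = dist p q"
proof -
  define x y z where "x = coords p" and "y = coords q" and "z = coords r"
  define a b c where "a = - mink x z" and "b = - mink z y" and "c = - mink x y"
  have ge: "a \<ge> 1" "b \<ge> 1" "c \<ge> 1"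
    using mink_coords_le by (simp_all add: a_def b_def c_def x_def y_def z_def minus_le_iff)
  have m: "mink x x = -1" "mink y y = -1" "mink z z = -1" "mink x y = - c" "mink y x = - c"
    "mink x z = - a" "mink z x = - a" "mink z y = - b" "mink y z = - b"
    by (simp_all add: x_def y_def z_def a_def b_def c_def mink_commute)
  have iff: "dist p r + dist r q = dist p q \<longleftrightarrow> c = a * b + sqrt (a\<^sup>2 - 1) * sqrt (b\<^sup>2 - 1)"
    using dist_add_eq_iff[of p r q] by (simp add: a_def b_def c_def x_def y_def z_def)
  have sq: "a\<^sup>2 \<ge> 1" "b\<^sup>2 \<ge> 1" "c\<^sup>2 \<ge> 1"
    using ge by (simp_all add: one_le_power)
  show ?thesis
  proof
    assume "r \<in> hyp_segment p q"
    then obtain s t where st: "s \<ge> 0" "t \<ge> 0" "z = s *\<^sub>R x + t *\<^sub>R y"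
      by (auto simp: hyp_segment_def x_def y_def z_def)
    have a: "a = s + t * c" and b: "b = s * c + t"
      using m(1,2,4,5) by (simp_all add: a_def b_def st(3) mink_simps)
    have one: "s\<^sup>2 + t\<^sup>2 + 2 * s * t * c = 1"
      using m(3) m(1,2,4,5) by (simp add: st(3) mink_simps power2_eq_square algebra_simps)
    have "a\<^sup>2 - 1 = t\<^sup>2 * (c\<^sup>2 - 1)" "b\<^sup>2 - 1 = s\<^sup>2 * (c\<^sup>2 - 1)"
      using a b one by algebra+
    then have "sqrt (a\<^sup>2 - 1) * sqrt (b\<^sup>2 - 1) = s * t * (c\<^sup>2 - 1)"
      using st sq by (simp add: real_sqrt_mult)
    moreover have "a * b + s * t * (c\<^sup>2 - 1) = c * (s\<^sup>2 + t\<^sup>2 + 2 * s * t * c)"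
      unfolding a b by (simp add: power2_eq_square algebra_simps)
    ultimately show "dist p r + dist r q = dist p q"
      by (simp add: iff one)
  next
    assume d: "dist p r + dist r q = dist p q"
    then have c: "c = a * b + sqrt (a\<^sup>2 - 1) * sqrt (b\<^sup>2 - 1)"
      by (simp add: iff)
    show "r \<in> hyp_segment p q"
    proof (cases "p = q")
      case True
      with d have "r = p"
        by (simp add: dist_commute)
      then show ?thesis
        unfolding hyp_segment_def mem_Collect_eq
        by (intro exI[of _ 1] exI[of _ 0]) simp
    next
      case False
      then have "c \<noteq> 1"
        using mink_coords_eq_iff[of p q] by (auto simp: c_def x_def y_def)
      with ge have c1: "c\<^sup>2 - 1 > 0"
        by (simp add: one_less_power)
      define w where "w = sqrt (a\<^sup>2 - 1) * sqrt (b\<^sup>2 - 1)"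
      have w: "w \<ge> 0" "w\<^sup>2 = (a\<^sup>2 - 1) * (b\<^sup>2 - 1)" "c = a * b + w"
        using sq c by (simp_all add: w_def power_mult_distrib)
      define s t where "s = (b * c - a) / (c\<^sup>2 - 1)" and "t = (a * c - b) / (c\<^sup>2 - 1)"
      have "b * c - a = a * (b\<^sup>2 - 1) + b * w" "a * c - b = b * (a\<^sup>2 - 1) + a * w"
        by (simp_all add: w(3) power2_eq_square algebra_simps)
      then have st: "s \<ge> 0" "t \<ge> 0"
        using ge sq w(1) c1 by (simp_all add: s_def t_def)
      have st': "s * (c\<^sup>2 - 1) = b * c - a" "t * (c\<^sup>2 - 1) = a * c - b"
        using c1 by (simp_all add: s_def t_def)
      have "(a - s - t * c) * (c\<^sup>2 - 1) = 0" "(b - s * c - t) * (c\<^sup>2 - 1) = 0"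
        using st' by algebra+
      then have ab: "a = s + t * c" "b = s * c + t"
        using c1 by auto
      have "(c - a * b)\<^sup>2 = (a\<^sup>2 - 1) * (b\<^sup>2 - 1)"
        using w(2,3) by simp
      then have "(s * a + t * b - 1) * (c\<^sup>2 - 1) = 0"
        using st' by algebra
      then have one: "s * a + t * b = 1"
        using c1 by auto
      define v where "v = z - s *\<^sub>R x - t *\<^sub>R y"
      have vx: "mink v x = 0" and vy: "mink v y = 0"
        using ab by (simp_all add: v_def mink_simps m)
      have vz: "mink v z = 0"
        using one by (simp add: v_def mink_simps m)
      have "mink v v = mink v z - s * mink v x - t * mink v y"
        by (subst (2) v_def) (simp add: mink_simps)
      then have "v = 0"
        using mink_orth_eq_0[of x v] m(1) vx vy vz by simp
      then have "z = s *\<^sub>R x + t *\<^sub>R y"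
        by (simp add: v_def algebra_simps)
      with st show ?thesis
        by (auto simp: hyp_segment_def x_def y_def z_def)
    qed
  qed
qed

lemma mink_add_coords_less_0: "mink (coords p + coords q) (coords p + coords q) < 0"
  using mink_coords_le[of p q] by (simp add: mink_simps mink_commute[of "coords q" "coords p"])

lemma hyp_midpoint_in_segment: "hyp_midpoint p q \<in> hyp_segment p q"
proof -
  define k where "k = 1 / sqrt (- mink (coords p + coords q) (coords p + coords q))"
  have "k \<ge> 0"
    using mink_add_coords_less_0[of p q] by (simp add: k_def)
  moreover have "coords (hyp_midpoint p q) = k *\<^sub>R coords p + k *\<^sub>R coords q"
    unfolding hyp_midpoint.rep_eq k_def[symmetric] by (simp add: scaleR_add_right)
  ultimately show ?thesis
    by (auto simp: hyp_segment_def)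
qed

lemma dist_hyp_midpoint: "dist p (hyp_midpoint p q) = dist q (hyp_midpoint p q)"
  unfolding dist_hyp_plane_def hyp_midpoint.rep_eq mink_scaleR_right mink_add_right
  by (simp add: mink_commute[of "coords q" "coords p"])

lemma dist_point_reflection:
  "dist (point_reflection m p) (point_reflection m q) = dist p q"
proof -
  have "mink (coords (point_reflection m p)) (coords (point_reflection m q)) =
      mink (coords p) (coords q)"
    unfolding point_reflection.rep_eq mink_simps mink_commute[of "coords p" "coords m"]
    by (simp add: algebra_simps)
  then show ?thesis by (simp add: dist_hyp_plane_def)
qed

lemma hyp_midpoint_point_reflection: "hyp_midpoint p (point_reflection m p) = m"
proof -
  define k where "k = - 2 * mink (coords m) (coords p)"
  have k: "k > 0"
    using mink_coords_le[of m p] by (simp add: k_def)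
  have sum: "coords p + coords (point_reflection m p) = k *\<^sub>R coords m"
    unfolding point_reflection.rep_eq k_def by simp
  have "coords (hyp_midpoint p (point_reflection m p)) = coords m"
    unfolding hyp_midpoint.rep_eq sum mink_simps
    using k by simp
  then show ?thesis by (simp add: coords_inject)
qed

end

theory Submission
  imports Defs
begin

text \<open>
  The upper bound is immediate: opposite points \<open>z\<close>, \<open>z'\<close> lie in \<open>K\<close> and on the two lines, so the
  distance of the lines is at most \<open>dist z z'\<close>.

  Conversely, let \<open>z\<close>, \<open>z'\<close> realise the diameter \<open>d\<close>, and take the lines through \<open>z\<close> and \<open>z'\<close>
  perpendicular to \<open>[z, z']\<close>.  The set \<open>K\<close> lies in the closed disc of radius \<open>d\<close> about \<open>z'\<close>, and the
  perpendicular at \<open>z\<close> is tangent to this disc, so it supports \<open>K\<close>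
  (\<open>cball_subset_half_plane\<close>); likewise at \<open>z'\<close>.  The point reflection in the midpoint of
  \<open>[z, z']\<close> interchanges \<open>z\<close> and \<open>z'\<close>, hence also the two perpendiculars
  (\<open>point_reflection_perpendicular\<close>), and \<open>[z, z']\<close> is their common perpendicular, so that their
  distance is \<open>d\<close> (\<open>setdist_perpendiculars\<close>).
  That \<open>z\<close> and \<open>z'\<close> are distinct boundary points of \<open>K\<close> holds because every point can be moved
  slightly away from any given point (\<open>ex_near_farther\<close>).
\<close>

lemma neg_mink_coords_ge_1: "- mink (coords p) (coords q) \<ge> 1"
  using mink_coords_le[of p q] by linarith

lemma dist_le_iff_mink:
  "dist p q \<le> dist r s \<longleftrightarrow> - mink (coords p) (coords q) \<le> - mink (coords r) (coords s)"
  unfolding cosh_dist[symmetric] by (simp add: cosh_real_nonneg_le_iff)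

lemma neg_mink_coords_gt_1:
  assumes "p \<noteq> q"
  shows "- mink (coords p) (coords q) > 1"
  using neg_mink_coords_ge_1[of p q] mink_coords_eq_iff[of p q] assms by fastforce

lemma upper_sheet_if_mink_neg:
  assumes v: "mink v v = -1" and neg: "mink v (coords p) < 0"
  shows "v $ 3 > 0"
proof (rule ccontr)
  assume "\<not> v $ 3 > 0"
  moreover have "v $ 3 \<noteq> 0"
  proof
    assume "v $ 3 = 0"
    then have "mink v v = (v $ 1)\<^sup>2 + (v $ 2)\<^sup>2"
      by (simp add: mink_def power2_eq_square)
    with v show False by (smt (verit) zero_le_power2)
  qed
  ultimately have "(- v) $ 3 > 0" by simp
  moreover have "mink (- v) (- v) = -1"
    using v by (simp add: mink_def)
  ultimately have "mink (- v) (coords p) \<le> -1"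
    by (intro mink_le_minus_one) (auto simp: coords_3_pos)
  with neg show False by (simp add: mink_def)
qed

lemma ex_unit_orthogonal: "\<exists>u. mink u u = 1 \<and> mink u (coords p) = 0"
proof -
  define y where "y = coords p"
  define v :: "real ^ 3" where "v = vector [y $ 3, 0, y $ 1]"
  have "mink y y = -1" by (simp add: y_def)
  then have vv: "mink v v = 1 + (y $ 2)\<^sup>2"
    by (simp add: mink_def v_def vector_3 power2_eq_square)
  then have pos: "mink v v > 0" by (simp add: add_pos_nonneg)
  have vy: "mink v y = 0"
    by (simp add: mink_def v_def vector_3)
  define k where "k = 1 / sqrt (mink v v)"
  have "k * (k * mink v v) = 1"
    using pos by (simp add: k_def field_simps)
  then have "mink (k *\<^sub>R v) (k *\<^sub>R v) = 1" "mink (k *\<^sub>R v) y = 0"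
    by (simp_all add: mink_scaleR_left mink_scaleR_right vy)
  then show ?thesis by (auto simp: y_def)
qed

lemma ex_near_farther:
  fixes p q :: hyp_plane
  assumes "e > 0"
  shows "\<exists>r. dist q r < e \<and> dist p q < dist p r"
proof -
  define x y where "x = coords p" and "y = coords q"
  \<comment> \<open>a unit tangent vector at \<open>q\<close> making an angle of at least \<open>\<pi>/2\<close> with the direction to \<open>p\<close>\<close>
  obtain u where u: "mink u u = 1" "mink u y = 0" "mink x u \<le> 0"
  proof -
    obtain v where v: "mink v v = 1" "mink v y = 0"
      using ex_unit_orthogonal[of q] by (auto simp: y_def)
    have neg: "mink (- v) (- v) = mink v v" "mink (- v) y = - mink v y"
      "mink x (- v) = - mink x v"
      by (simp_all add: mink_def)
    show ?thesis
    proof (cases "mink x v \<le> 0")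
      case True
      with v that[of v] show ?thesis by simp
    next
      case False
      with v neg that[of "- v"] show ?thesis by simp
    qed
  qed
  define h where "h = e / 2"
  have h: "h > 0" "h < e" using assms by (simp_all add: h_def)
  define v where "v = cosh h *\<^sub>R y + sinh h *\<^sub>R u"
  have m: "mink y y = -1" "mink y u = 0"
    using u(2) by (simp_all add: y_def mink_commute)
  have "mink v v = (sinh h)\<^sup>2 - (cosh h)\<^sup>2"
    by (simp add: v_def mink_simps m u power2_eq_square)
  then have vv: "mink v v = -1"
    by (simp add: cosh_square_eq)
  have vy: "mink v y = - cosh h"
    by (simp add: v_def mink_simps m u)
  have "v $ 3 > 0"
    using upper_sheet_if_mink_neg[of v q] vv vy cosh_real_pos[of h] by (simp add: y_def)
  with vv have r: "coords (Abs_hyp_plane v) = v"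
    by (simp add: Abs_hyp_plane_inverse)
  let ?r = "Abs_hyp_plane v"
  have "cosh (dist q ?r) = cosh h"
    by (simp add: cosh_dist r flip: y_def) (simp add: vy mink_commute[of y v])
  then have "dist q ?r = h"
    by (metis arcosh_cosh_real h(1) less_imp_le zero_le_dist)
  moreover have "dist p q < dist p ?r"
  proof -
    have ge: "- mink x y \<ge> 1"
      using neg_mink_coords_ge_1 by (simp add: x_def y_def)
    have "cosh h > 1"
      using h cosh_real_strict_mono[of 0 h] by simp
    with ge have "- mink x y < cosh h * (- mink x y)" by simp
    also have "\<dots> \<le> cosh h * (- mink x y) - sinh h * mink x u"
      using u(3) h by (simp add: mult_nonneg_nonpos)
    also have "\<dots> = - mink x v"
      by (simp add: v_def mink_simps)
    finally show ?thesis
      using dist_le_iff_mink[of p ?r p q] by (simp add: r not_le flip: x_def y_def)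
  qed
  ultimately show ?thesis using h by auto
qed

lemma not_interior_if_farthest:
  fixes p q :: hyp_plane
  assumes "\<And>r. r \<in> K \<Longrightarrow> dist p r \<le> dist p q"
  shows "q \<notin> interior K"
proof
  assume "q \<in> interior K"
  then obtain e where e: "e > 0" "ball q e \<subseteq> K"
    by (auto simp: mem_interior)
  obtain r where "dist q r < e" "dist p q < dist p r"
    using ex_near_farther[OF e(1)] by blast
  with e(2) assms[of r] show False by auto
qed

text \<open>
  A normal vector of the line through \<open>p\<close> perpendicular to the line \<open>pq\<close>, for \<open>p \<noteq> q\<close>: it is the
  component of \<open>- coords q\<close> orthogonal to \<open>coords p\<close>, so that \<open>q\<close> lies in the half-plane of
  nonpositive values.
\<close>

definition perp_normal :: "hyp_plane \<Rightarrow> hyp_plane \<Rightarrow> real ^ 3" where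
  "perp_normal p q = (- mink (coords p) (coords q)) *\<^sub>R coords p - coords q"

lemma mink_perp_normal:
  "mink (perp_normal p q) v = - mink (coords p) (coords q) * mink (coords p) v - mink (coords q) v"
  by (simp add: perp_normal_def mink_diff_left mink_scaleR_left del: scaleR_minus_left)

lemma mem_line_perp_normal_iff:
  "r \<in> line_of (perp_normal p q) \<longleftrightarrow>
    mink (coords q) (coords r) = - mink (coords p) (coords q) * mink (coords p) (coords r)"
  by (auto simp: line_of_def mink_perp_normal)

lemma spacelike_perp_normal:
  assumes "p \<noteq> q"
  shows "spacelike (perp_normal p q)"
proof -
  define c where "c = - mink (coords p) (coords q)"
  have "mink (perp_normal p q) (perp_normal p q) = c\<^sup>2 - 1"
    unfolding perp_normal_def c_def[symmetric]
    by (simp add: mink_simps mink_commute[of "coords q" "coords p"])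
      (simp add: c_def power2_eq_square)
  moreover have "c\<^sup>2 > 1"
    using neg_mink_coords_gt_1[OF assms] unfolding c_def by (rule one_less_power) simp
  ultimately show ?thesis by (simp add: spacelike_def)
qed

lemma mem_line_perp_normal: "p \<in> line_of (perp_normal p q)"
  by (simp add: mem_line_perp_normal_iff mink_commute)

lemma not_mem_line_perp_normal:
  assumes "p \<noteq> q"
  shows "q \<notin> line_of (perp_normal p q)"
proof
  define c where "c = - mink (coords p) (coords q)"
  assume "q \<in> line_of (perp_normal p q)"
  then have "c * c = 1"
    by (simp add: mem_line_perp_normal_iff c_def)
  moreover have "c > 1"
    using neg_mink_coords_gt_1[OF assms] by (simp add: c_def)
  ultimately show False
    using mult_strict_mono[of 1 c 1 c] by simp
qed

text \<open>The perpendicular at \<open>p\<close> is tangent to the disc about \<open>q\<close> through \<open>p\<close>.\<close>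

lemma cball_subset_half_plane: "cball q (dist q p) \<subseteq> half_plane (perp_normal p q)"
proof
  fix r assume "r \<in> cball q (dist q p)"
  then have "- mink (coords q) (coords r) \<le> - mink (coords p) (coords q)"
    by (simp add: dist_le_iff_mink mink_commute[of "coords p" "coords q"])
  also have "\<dots> \<le> (- mink (coords p) (coords q)) * (- mink (coords p) (coords r))"
    using mult_left_mono[of 1 "- mink (coords p) (coords r)" "- mink (coords p) (coords q)"]
      neg_mink_coords_ge_1[of p q] neg_mink_coords_ge_1[of p r]
    by linarith
  finally show "r \<in> half_plane (perp_normal p q)"
    by (simp add: half_plane_def mink_perp_normal)
qed

lemma supporting_line_perp_normal:
  assumes "closed K" "p \<in> K" "p \<noteq> q"
    and far: "\<And>r. r \<in> K \<Longrightarrow> dist q r \<le> dist q p"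
  shows "supporting_line K p (line_of (perp_normal p q))"
proof -
  have "p \<in> frontier K"
    using assms(1,2) not_interior_if_farthest[OF far] by (simp add: frontier_def closure_closed)
  moreover have "K \<subseteq> half_plane (perp_normal p q)"
    using far cball_subset_half_plane[of q p] by auto
  ultimately show ?thesis
    unfolding supporting_line_def
    using mem_line_perp_normal[of p q] spacelike_perp_normal[OF assms(3)] by blast
qed

lemma point_reflection_involution: "point_reflection m (point_reflection m p) = p"
proof -
  have "mink (coords m) (coords (point_reflection m p)) = mink (coords m) (coords p)"
    by (simp add: point_reflection.rep_eq mink_simps del: scaleR_minus_left)
  then have "coords (point_reflection m (point_reflection m p)) = coords p"
    by (simp add: point_reflection.rep_eq[of m "point_reflection m p"])
      (simp add: point_reflection.rep_eq)
  then show ?thesis by (simp add: coords_inject)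
qed

lemma mink_point_reflection:
  "mink (coords (point_reflection m p)) (coords (point_reflection m q)) =
    mink (coords p) (coords q)"
  using dist_point_reflection[of m p q] cosh_dist[of p q]
    cosh_dist[of "point_reflection m p" "point_reflection m q"] by simp

lemma point_reflection_hyp_midpoint: "point_reflection (hyp_midpoint p q) p = q"
proof -
  define x y c where "x = coords p" and "y = coords q" and "c = - mink x y"
  define k where "k = 1 / sqrt (- mink (x + y) (x + y))"
  have c: "c \<ge> 1"
    using neg_mink_coords_ge_1 by (simp add: c_def x_def y_def)
  have m: "mink x x = -1" "mink y y = -1" "mink x y = - c" "mink y x = - c"
    by (simp_all add: x_def y_def c_def mink_commute)
  have "- mink (x + y) (x + y) = 2 * (1 + c)"
    by (simp add: mink_simps m)
  then have "k * k * (2 * (1 + c)) = 1"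
    using c by (simp add: k_def field_simps)
  moreover have "- 2 * mink (k *\<^sub>R (x + y)) x * k = k * k * (2 * (1 + c))"
    by (simp add: mink_simps m algebra_simps)
  ultimately have one: "- 2 * mink (k *\<^sub>R (x + y)) x * k = 1"
    by simp
  have mid: "coords (hyp_midpoint p q) = k *\<^sub>R (x + y)"
    by (simp add: hyp_midpoint.rep_eq k_def x_def y_def)
  have "coords (point_reflection (hyp_midpoint p q) p) = y"
    unfolding point_reflection.rep_eq mid x_def[symmetric] scaleR_scaleR one by simp
  then show ?thesis by (simp add: y_def coords_inject)
qed

lemma point_reflection_perpendicular:
  "point_reflection (hyp_midpoint p q) ` line_of (perp_normal p q) = line_of (perp_normal q p)"
proof -
  let ?R = "point_reflection (hyp_midpoint p q)"
  have p: "?R p = q"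
    by (rule point_reflection_hyp_midpoint)
  then have q: "?R q = p"
    using point_reflection_involution[of "hyp_midpoint p q" p] by simp
  have *: "?R r \<in> line_of (perp_normal q p) \<longleftrightarrow> r \<in> line_of (perp_normal p q)" for r
    using mink_point_reflection[of "hyp_midpoint p q" p r]
      mink_point_reflection[of "hyp_midpoint p q" q r]
    by (simp add: mem_line_perp_normal_iff p q mink_commute[of "coords q" "coords p"])
  show ?thesis
  proof (intro equalityI subsetI)
    fix r assume "r \<in> line_of (perp_normal q p)"
    then have "?R r \<in> line_of (perp_normal p q)"
      using *[of "?R r"] by (simp add: point_reflection_involution)
    then have "?R (?R r) \<in> ?R ` line_of (perp_normal p q)"
      by (rule imageI)
    then show "r \<in> ?R ` line_of (perp_normal p q)"
      by (simp add: point_reflection_involution)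
  qed (use * in auto)
qed

text \<open>The segment \<open>[p, q]\<close> realises the distance of the perpendiculars at its endpoints.\<close>

lemma dist_perpendiculars_le:
  assumes r: "r \<in> line_of (perp_normal p q)" and s: "s \<in> line_of (perp_normal q p)"
  shows "dist p q \<le> dist r s"
proof -
  define x y u v where "x = coords p" and "y = coords q" and "u = coords r" and "v = coords s"
  define a b c where "a = - mink x u" and "b = - mink y v" and "c = - mink x y"
  have ge: "a \<ge> 1" "b \<ge> 1" "c \<ge> 1"
    using neg_mink_coords_ge_1 by (simp_all add: a_def b_def c_def x_def y_def u_def v_def)
  have ab: "a * b \<ge> 1"
    using ge mult_mono[of 1 a 1 b] by simp
  have yu: "mink y u = - (c * a)" and xv: "mink x v = - (c * b)"
    using r s unfolding mem_line_perp_normal_iff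
    by (simp_all add: a_def b_def c_def x_def y_def u_def v_def mink_commute)
  have m: "mink x x = -1" "mink y y = -1" "mink u u = -1" "mink v v = -1"
    "mink x y = - c" "mink y x = - c" "mink x u = - a" "mink u x = - a"
    "mink y v = - b" "mink v y = - b" "mink y u = - (c * a)" "mink u y = - (c * a)"
    "mink x v = - (c * b)" "mink v x = - (c * b)"
    using yu xv
    by (simp_all add: x_def y_def u_def v_def a_def b_def c_def mink_commute)
  \<comment> \<open>The components of \<open>u\<close> and \<open>v\<close> orthogonal to both \<open>x\<close> and \<open>y\<close>; their squares are \<open>a\<^sup>2 - 1\<close> and
    \<open>b\<^sup>2 - 1\<close>, and the form is positive definite on the complement of \<open>x\<close>.\<close>
  define u' v' where "u' = u - a *\<^sub>R x" and "v' = v - b *\<^sub>R y"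
  have orth: "mink (b *\<^sub>R u' - a *\<^sub>R v') x = 0"
    by (simp add: u'_def v'_def mink_simps m)
  have uu: "mink u' u' = a\<^sup>2 - 1" and vv: "mink v' v' = b\<^sup>2 - 1"
    and uv: "mink u' v' = mink u v + a * b * c"
    by (simp_all add: u'_def v'_def mink_simps m power2_eq_square algebra_simps)
  have "0 \<le> mink (b *\<^sub>R u' - a *\<^sub>R v') (b *\<^sub>R u' - a *\<^sub>R v')"
    using mink_orth_nonneg[OF m(1) orth] .
  also have "\<dots> = b\<^sup>2 * mink u' u' + a\<^sup>2 * mink v' v' - 2 * (a * b) * mink u' v'"
    by (simp add: mink_simps mink_commute[of v' u'] power2_eq_square algebra_simps)
  also have "\<dots> = 2 * (a * b) * (a * b - mink u' v') - (a\<^sup>2 + b\<^sup>2)"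
    by (simp add: uu vv power2_eq_square algebra_simps)
  also have "\<dots> \<le> 2 * (a * b) * (a * b - mink u' v') - 2 * (a * b)"
    using sum_squares_bound[of a b] by (simp add: mult.assoc)
  also have "\<dots> = 2 * (a * b) * (a * b - 1 - mink u' v')"
    by (simp add: algebra_simps)
  finally have "mink u' v' \<le> a * b - 1"
    using ab by (simp add: zero_le_mult_iff)
  moreover have "c - 1 \<le> a * b * (c - 1)"
    using ab ge mult_right_mono[of 1 "a * b" "c - 1"] by simp
  ultimately have "c \<le> - mink u v"
    using uv by (simp add: algebra_simps)
  then show ?thesis
    unfolding dist_le_iff_mink by (simp add: c_def x_def y_def u_def v_def)
qed

lemma setdist_perpendiculars:
  "setdist (line_of (perp_normal p q)) (line_of (perp_normal q p)) = dist p q"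
proof (rule antisym)
  show "setdist (line_of (perp_normal p q)) (line_of (perp_normal q p)) \<le> dist p q"
    by (intro setdist_le_dist mem_line_perp_normal)
  have "line_of (perp_normal p q) \<noteq> {}" for p q
    using mem_line_perp_normal by blast
  then show "dist p q \<le> setdist (line_of (perp_normal p q)) (line_of (perp_normal q p))"
    by (intro le_setdistI dist_perpendiculars_le)
qed

lemma jcjl_width_le_dist:
  assumes "opposite K z l z'"
  shows "jcjl_width K z l z' \<le> dist z z'"
proof -
  from assms obtain l' where l: "supporting_line K z l" and l': "opposite_line K z l z' l'"
    by (auto simp: opposite_def)
  then have "z \<in> l" "z' \<in> l'"
    by (auto simp: opposite_line_def supporting_line_def)
  then show ?thesis
    unfolding jcjl_width_eq[OF l'] by (rule setdist_le_dist)
qed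

theorem corollary6p6:
  fixes K :: "hyp_plane set"
  assumes "convex_body K"
  shows "diameter K \<in> {jcjl_width K z l z' | z l z'. opposite K z l z'} \<and>
    (\<forall>w \<in> {jcjl_width K z l z' | z l z'. opposite K z l z'}. w \<le> diameter K)"
proof
  have K: "compact K" "interior K \<noteq> {}"
    using assms by (auto simp: convex_body_def)
  then have cl: "closed K" and bd: "bounded K" and ne: "K \<noteq> {}"
    by (auto simp: compact_imp_closed compact_imp_bounded)
  obtain z z' where z: "z \<in> K" "z' \<in> K" "dist z z' = diameter K"
    using diameter_compact_attained[OF K(1) ne] by blast
  have far: "dist z' r \<le> dist z' z" "dist z r \<le> dist z z'" if "r \<in> K" for r
    using that z diameter_bounded_bound[OF bd] by (simp_all add: dist_commute)
  have neq: "z \<noteq> z'"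
  proof
    assume "z = z'"
    then have "r = z" if "r \<in> K" for r
      using far(1)[OF that] by simp
    moreover obtain q where "q \<in> interior K"
      using K(2) by blast
    ultimately have "z \<in> interior K"
      using interior_subset by blast
    then show False
      using not_interior_if_farthest[of K z' z] far(1) by blast
  qed
  let ?l = "line_of (perp_normal z z')" and ?l' = "line_of (perp_normal z' z)"
  have l: "supporting_line K z ?l" and l': "supporting_line K z' ?l'"
    using supporting_line_perp_normal cl z far neq by auto
  have "?l' \<noteq> ?l"
    using mem_line_perp_normal[of z z'] not_mem_line_perp_normal[of z' z] neq by auto
  with l' have opp: "opposite_line K z ?l z' ?l'"
    by (simp add: opposite_line_def point_reflection_perpendicular)
  then have "jcjl_width K z ?l z' = diameter K"
    using z(3) by (simp add: jcjl_width_eq setdist_perpendiculars)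
  moreover have "opposite K z ?l z'"
    using l neq opp by (auto simp: opposite_def)
  ultimately show "diameter K \<in> {jcjl_width K z l z' | z l z'. opposite K z l z'}"
    by force
  show "\<forall>w \<in> {jcjl_width K z l z' | z l z'. opposite K z l z'}. w \<le> diameter K"
  proof clarify
    fix z l z' assume opp: "opposite K z l z'"
    then have "z \<in> frontier K" "z' \<in> frontier K"
      by (auto simp: opposite_def opposite_line_def supporting_line_def)
    then have "z \<in> K" "z' \<in> K"
      using frontier_subset_closed[OF cl] by auto
    then have "dist z z' \<le> diameter K"
      by (rule diameter_bounded_bound[OF bd])
    with jcjl_width_le_dist[OF opp] show "jcjl_width K z l z' \<le> diameter K"
      by linarith
  qed
qed

end
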